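(* Suppose $0<\alpha\le 1$ and $m\ge 0$. Let $$q_2=\left(1-\frac{1}{(\alpha+1)^{1/2}}\right)\left(n+\left((\alpha+1)^{1/2}-1\right)m\right).$$ Then for $q>q_2$ the constrained variational problem $(P_0)$ on $\Omega$ has a global minimizer, and every global minimizer takes (almost everywhere) the form $$\mathbf u=\mathbf a\,\chi_U+\mathbf b\,\chi_{\Omega\setminus U},$$ where $U\subset\Omega$ is a measurable set of size $$|U|=\frac{(\alpha+1)^{1/2}m}{n+((\alpha+1)^{1/2}-1)m}\,|\Omega|,$$ $$\mathbf a=\left(\sqrt{\frac{A}{(\alpha+1)^{1/2}}},\,0,\,0\right),\qquad \mathbf b=\left(0,\sqrt{A},0\right),\qquad A=n+\left((\alpha+1)^{1/2}-1\right)m.$$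
   Context: $\Omega\subset\mathbb R^3$ is a bounded domain with smooth boundary, $|\cdot|$ denotes Lebesgue measure, $\chi_S$ is the characteristic function of a set $S$, and $\mathbb R_+=[0,\infty)$. Real numbers $\alpha$, $q$, $N>0$, $M$ are given with $0\le M\le N$; put $n=N/|\Omega|$ and $m=M/|\Omega|$. A vector is written $\mathbf u=(u_1,u_0,u_{-1})\in\mathbb R_+^3$. The Thomas-Fermi Hamiltonian is $$H_{TF}(\mathbf u)=\tfrac12(u_1^2+u_0^2+u_{-1}^2)^2+\tfrac{\alpha}{2}\left[2u_0^2(u_1-\mathrm{sgn}(\alpha)u_{-1})^2+(u_1^2-u_{-1}^2)^2\right]+q(u_1^2+u_{-1}^2).$$ Problem $(P_0)$: minimize $\int_\Omega H_{TF}(\mathbf u(x))\,dx$ over all $\mathbf u\in (L^2(\Omega,\mathbb R_+))^3$ subject to $\int_\Omega (u_1^2+u_0^2+u_{-1}^2)\,dx=N$ and $\int_\Omega (u_1^2-u_{-1}^2)\,dx=M$. *)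

theory Defs
  imports "HOL-Analysis.Analysis"
begin

text \<open>Meaningful for open \<open>V\<close> only: the derivative is taken at the full neighbourhood filter of the point.\<close>

primrec Ck_on :: "nat \<Rightarrow> (real^3) set \<Rightarrow> (real^3 \<Rightarrow> real) \<Rightarrow> bool" where
  "Ck_on 0 V f \<longleftrightarrow> continuous_on V f"
| "Ck_on (Suc k) V f \<longleftrightarrow> f differentiable_on V \<and>
     (\<forall>i. Ck_on k V (\<lambda>x. frechet_derivative f (at x) (axis i 1)))"

definition smooth_on :: "(real^3) set \<Rightarrow> (real^3 \<Rightarrow> real) \<Rightarrow> bool" where
  "smooth_on V f \<longleftrightarrow> (\<forall>k. Ck_on k V f)"

text \<open>Near each boundary point the set is the strict sublevel set of a smooth function without
  critical points, i.e. it lies on one side of a smooth hypersurface.\<close>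

definition smooth_boundary :: "(real^3) set \<Rightarrow> bool" where
  "smooth_boundary \<Omega> \<longleftrightarrow> (\<forall>p\<in>frontier \<Omega>. \<exists>V \<rho>. open V \<and> p \<in> V \<and> smooth_on V \<rho> \<and>
     (\<forall>x\<in>V. frechet_derivative \<rho> (at x) \<noteq> (\<lambda>_. 0)) \<and> \<Omega> \<inter> V = {x \<in> V. \<rho> x < 0})"

definition bounded_smooth_domain :: "(real^3) set \<Rightarrow> bool" where
  "bounded_smooth_domain \<Omega> \<longleftrightarrow>
     \<Omega> \<noteq> {} \<and> open \<Omega> \<and> connected \<Omega> \<and> bounded \<Omega> \<and> smooth_boundary \<Omega>"

text \<open>Vectors are written \<open>(u1, u0, um)\<close>, with \<open>um\<close> for the component of index \<open>-1\<close>.\<close>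

type_synonym spin = "real \<times> real \<times> real"

fun H_TF :: "real \<Rightarrow> real \<Rightarrow> spin \<Rightarrow> real" where
  "H_TF \<alpha> q (u1, u0, um) =
     1/2 * (u1\<^sup>2 + u0\<^sup>2 + um\<^sup>2)\<^sup>2
     + \<alpha>/2 * (2 * u0\<^sup>2 * (u1 - sgn \<alpha> * um)\<^sup>2 + (u1\<^sup>2 - um\<^sup>2)\<^sup>2)
     + q * (u1\<^sup>2 + um\<^sup>2)"

text \<open>Elements of \<open>L\<^sup>2\<close> are represented by functions; their values outside \<open>\<Omega>\<close> are irrelevant.\<close>

definition L2_nonneg :: "(real^3) set \<Rightarrow> (real^3 \<Rightarrow> real) \<Rightarrow> bool" where
  "L2_nonneg \<Omega> f \<longleftrightarrow> f \<in> borel_measurable (lebesgue_on \<Omega>) \<and>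
     integrable (lebesgue_on \<Omega>) (\<lambda>x. (f x)\<^sup>2) \<and> (AE x in lebesgue_on \<Omega>. 0 \<le> f x)"

definition admissible :: "(real^3) set \<Rightarrow> real \<Rightarrow> real \<Rightarrow> (real^3 \<Rightarrow> spin) \<Rightarrow> bool" where
  "admissible \<Omega> N M u \<longleftrightarrow>
     L2_nonneg \<Omega> (\<lambda>x. fst (u x)) \<and>
     L2_nonneg \<Omega> (\<lambda>x. fst (snd (u x))) \<and>
     L2_nonneg \<Omega> (\<lambda>x. snd (snd (u x))) \<and>
     (LINT x|lebesgue_on \<Omega>. (case u x of (u1, u0, um) \<Rightarrow> u1\<^sup>2 + u0\<^sup>2 + um\<^sup>2)) = N \<and>
     (LINT x|lebesgue_on \<Omega>. (case u x of (u1, u0, um) \<Rightarrow> u1\<^sup>2 - um\<^sup>2)) = M"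

text \<open>\<open>H_TF\<close> is quartic, so its integral over an \<open>L\<^sup>2\<close> function may be \<open>\<infinity>\<close>. The Bochner
  integral would return 0 there, hence the extended-valued integral (positive part minus
  negative part). For \<open>\<alpha> \<ge> 0\<close> the negative part of \<open>H_TF \<circ> u\<close> is at most \<open>\<bar>q\<bar> (u1\<^sup>2 + um\<^sup>2)\<close>,
  so the difference is never \<open>\<infinity> - \<infinity>\<close>.\<close>

definition energy :: "(real^3) set \<Rightarrow> real \<Rightarrow> real \<Rightarrow> (real^3 \<Rightarrow> spin) \<Rightarrow> ereal" where
  "energy \<Omega> \<alpha> q u =
     enn2ereal (\<integral>\<^sup>+x. ennreal (H_TF \<alpha> q (u x)) \<partial>lebesgue_on \<Omega>)
     - enn2ereal (\<integral>\<^sup>+x. ennreal (- H_TF \<alpha> q (u x)) \<partial>lebesgue_on \<Omega>)"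

definition global_minimizer_P0 ::
    "(real^3) set \<Rightarrow> real \<Rightarrow> real \<Rightarrow> real \<Rightarrow> real \<Rightarrow> (real^3 \<Rightarrow> spin) \<Rightarrow> bool" where
  "global_minimizer_P0 \<Omega> \<alpha> q N M u \<longleftrightarrow> admissible \<Omega> N M u \<and>
     (\<forall>v. admissible \<Omega> N M v \<longrightarrow> energy \<Omega> \<alpha> q u \<le> energy \<Omega> \<alpha> q v)"

end

theory Submission
  imports Defs
begin

text \<open>
  Put \<open>s = sqrt (\<alpha> + 1)\<close> and \<open>x = u1\<^sup>2\<close>, \<open>y = u0\<^sup>2\<close>, \<open>z = um\<^sup>2\<close>. Convexity suggests comparing
  \<open>H_TF\<close> with the function \<open>A (s x + y + (2 - s) z) - A\<^sup>2/2 + q (x - z)\<close>, which is affine in the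
  densities \<open>x + y + z\<close> and \<open>x - z\<close> and so has the same integral for every admissible \<open>u\<close>. The
  difference is an explicit sum of nonnegative terms. The one carrying \<open>q\<close> is \<open>2 (q - q2) z\<close>; for
  \<open>q > q2\<close> the sum vanishes only if \<open>z = 0\<close>, \<open>x y = 0\<close> and \<open>y + s x = A\<close>, that is, at \<open>a\<close> and \<open>b\<close>.
  So the minimizers are the admissible functions with values in \<open>{a, b}\<close>, and the magnetization
  constraint fixes the measure of the set where the value is \<open>a\<close>.
\<close>

section \<open>Extended-valued integrals and integrable minorants\<close>

text \<open>The pattern of \<open>energy\<close> for an arbitrary measure and integrand, so that the
  comparison with a minorant can be made independently of spins.\<close>

definition integral_diff :: "'a measure \<Rightarrow> ('a \<Rightarrow> real) \<Rightarrow> ereal" where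
  "integral_diff M h = enn2ereal (\<integral>\<^sup>+x. ennreal (h x) \<partial>M) - enn2ereal (\<integral>\<^sup>+x. ennreal (- h x) \<partial>M)"

lemma integral_diff_integrable:
  assumes "integrable M h"
  shows "integral_diff M h = ereal (integral\<^sup>L M h)"
proof -
  have f: "(\<integral>\<^sup>+x. ennreal (h x) \<partial>M) \<noteq> \<infinity>" "(\<integral>\<^sup>+x. ennreal (- h x) \<partial>M) \<noteq> \<infinity>"
    using assms by (simp_all add: real_integrable_def)
  have e: "enn2ereal c = ereal (enn2real c)" if "c \<noteq> \<infinity>" for c
    using that by (cases c) (simp_all add: enn2ereal_ennreal)
  show ?thesis
    unfolding integral_diff_def real_lebesgue_integral_def[OF assms] e[OF f(1)] e[OF f(2)] by simp
qed

text \<open>The negative part of \<open>h\<close> lies below that of \<open>g\<close>, so its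
  integral is finite; an infinite integral of the positive part would then make the difference
  \<open>\<infinity>\<close>, against \<open>fin\<close>.\<close>

lemma integral_diff_bounded_below:
  assumes g: "integrable M g" and h: "h \<in> borel_measurable M" and le: "AE x in M. g x \<le> h x"
    and fin: "integral_diff M h \<noteq> \<infinity>"
  shows "integrable M h"
proof -
  have "(\<integral>\<^sup>+x. ennreal (- h x) \<partial>M) \<le> (\<integral>\<^sup>+x. ennreal (- g x) \<partial>M)"
    using le by (intro nn_integral_mono_AE) (auto intro!: ennreal_leI elim!: eventually_mono)
  also have "\<dots> < \<infinity>"
    using g by (simp add: real_integrable_def less_top)
  finally have neg: "(\<integral>\<^sup>+x. ennreal (- h x) \<partial>M) \<noteq> \<infinity>" by simp
  moreover have "(\<integral>\<^sup>+x. ennreal (h x) \<partial>M) \<noteq> \<infinity>"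
  proof
    assume "(\<integral>\<^sup>+x. ennreal (h x) \<partial>M) = \<infinity>"
    with neg fin show False
      by (cases "\<integral>\<^sup>+x. ennreal (- h x) \<partial>M") (auto simp: integral_diff_def enn2ereal_ennreal)
  qed
  ultimately show ?thesis using h by (simp add: real_integrable_def)
qed

lemma integral_diff_ge:
  assumes g: "integrable M g" and h: "h \<in> borel_measurable M" and le: "AE x in M. g x \<le> h x"
  shows "ereal (integral\<^sup>L M g) \<le> integral_diff M h"
proof (cases "integral_diff M h = \<infinity>")
  case False
  from integral_diff_bounded_below[OF assms False] have i: "integrable M h" .
  show ?thesis using integral_mono_AE[OF g i le] by (simp add: integral_diff_integrable[OF i])
qed simp

text \<open>The two integrals must coincide, so the nonnegative function \<open>h - g\<close> has
  integral 0. This turns minimality of the energy into a pointwise equation.\<close>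

lemma integral_diff_eq_imp_AE:
  assumes g: "integrable M g" and h: "h \<in> borel_measurable M" and le: "AE x in M. g x \<le> h x"
    and upper: "integral_diff M h \<le> ereal (integral\<^sup>L M g)"
  shows "AE x in M. h x = g x"
proof -
  have "integral_diff M h \<noteq> \<infinity>" using upper by auto
  from integral_diff_bounded_below[OF g h le this] have i: "integrable M h" .
  have "(LINT x|M. h x - g x) = 0"
    using integral_mono_AE[OF g i le] upper g i by (simp add: integral_diff_integrable[OF i])
  moreover have "AE x in M. 0 \<le> h x - g x" using le by auto
  ultimately have "AE x in M. h x - g x = 0"
    using integral_nonneg_eq_0_iff_AE[of M "\<lambda>x. h x - g x"] g i by simp
  then show ?thesis by auto
qed

section \<open>Subsets of prescribed Lebesgue measure\<close>

text \<open>Intersect \<open>S\<close> with closed balls around the origin: the measure varies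
  continuously with the radius, from 0 up to the measure of \<open>S\<close>, so the intermediate
  value theorem applies.\<close>

lemma lmeasurable_subset_of_measure:
  fixes S :: "'a::euclidean_space set"
  assumes S: "S \<in> lmeasurable" "bounded S" and t: "0 \<le> t" "t \<le> measure lebesgue S"
  obtains U where "U \<in> sets lebesgue" "U \<subseteq> S" "measure lebesgue U = t"
proof -
  define f where "f r = measure lebesgue (S \<inter> cball 0 r)" for r
  define g where "g r = measure lebesgue (cball 0 r :: 'a set)" for r
  obtain K where K: "0 < K" "S \<subseteq> cball 0 K"
    using S(2) unfolding bounded_pos subset_iff mem_cball_0 by blast
  have m: "S \<inter> cball 0 r \<in> lmeasurable" for r
    using S(1) by (intro fmeasurable.Int) auto
  \<comment> \<open>What \<open>S\<close> gains between two radii lies in a spherical shell, so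
    \<open>f\<close> inherits continuity from the ball volume \<open>g\<close>.\<close>
  have lip: "\<bar>f y - f x\<bar> \<le> \<bar>g y - g x\<bar>" if "x \<le> y" for x y
  proof -
    have sub: "cball 0 x \<subseteq> (cball 0 y :: 'a set)" using that by auto
    have "f y - f x = measure lebesgue ((S \<inter> cball 0 y) - (S \<inter> cball 0 x))"
      unfolding f_def using sub m by (intro measurable_measure_Diff[symmetric]) auto
    also have "\<dots> \<le> measure lebesgue (cball 0 y - cball 0 x :: 'a set)"
      using m by (intro measure_mono_fmeasurable) auto
    also have "\<dots> = g y - g x"
      unfolding g_def using sub by (intro measurable_measure_Diff) auto
    finally have "f y - f x \<le> g y - g x" .
    moreover have "f x \<le> f y"
      unfolding f_def using sub m by (intro measure_mono_fmeasurable) auto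
    ultimately show ?thesis by simp
  qed
  have lip': "\<bar>f y - f x\<bar> \<le> \<bar>g y - g x\<bar>" for x y
    using lip[of x y] lip[of y x] by (cases "x \<le> y") (auto simp: abs_minus_commute)
  have cg: "continuous_on {0..K} g"
  proof (rule continuous_on_eq)
    show "continuous_on {0..K} (\<lambda>r. unit_ball_vol (real DIM('a)) * r ^ DIM('a))"
      by (intro continuous_intros)
  qed (simp add: g_def content_cball)
  have cf: "continuous_on {0..K} f"
    unfolding continuous_on_iff
  proof (intro ballI allI impI)
    fix x e :: real assume "x \<in> {0..K}" "0 < e"
    then obtain d where "d > 0" "\<forall>x'\<in>{0..K}. dist x' x < d \<longrightarrow> dist (g x') (g x) < e"
      using cg unfolding continuous_on_iff by blast
    then show "\<exists>d>0. \<forall>x'\<in>{0..K}. dist x' x < d \<longrightarrow> dist (f x') (f x) < e"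
      using lip' by (intro exI[of _ d]) (auto simp: dist_real_def intro: le_less_trans)
  qed
  \<comment> \<open>The ball of radius 0 is a single point, so \<open>g 0\<close> is 0.\<close>
  have "f 0 \<le> g 0"
    unfolding f_def g_def using m[of 0] by (intro measure_mono_fmeasurable fmeasurableD lmeasurable_cball) auto
  then have "f 0 \<le> t" using t by (simp add: g_def)
  moreover have "t \<le> f K" using t K by (simp add: f_def Int_absorb2)
  ultimately obtain r where "f r = t" using IVT'[of f 0 t K] cf K by auto
  then show ?thesis using that[of "S \<inter> cball 0 r"] m by (auto simp: f_def)
qed

section \<open>The pointwise lower bound for the Hamiltonian\<close>

text \<open>The coefficients \<open>A\<close> and \<open>(s - 1) * A + q\<close> are the Lagrange
  multipliers of mass and magnetization. With \<open>\<alpha> = s\<^sup>2 - 1\<close>, the pure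
  phases have energies \<open>y\<^sup>2 / 2\<close> for \<open>y = u0\<^sup>2\<close> and
  \<open>s\<^sup>2 * x\<^sup>2 / 2 + q * x\<close> for \<open>x = u1\<^sup>2\<close>; the function
  is tangent to both, at \<open>y = A\<close> and \<open>x = A / s\<close>.\<close>

definition affine_minorant :: "real \<Rightarrow> real \<Rightarrow> real \<Rightarrow> spin \<Rightarrow> real" where
  "affine_minorant s A q = (\<lambda>(u1, u0, um).
     A * ((u1\<^sup>2 + u0\<^sup>2 + um\<^sup>2) + (s - 1) * (u1\<^sup>2 - um\<^sup>2)) - A\<^sup>2 / 2 + q * (u1\<^sup>2 - um\<^sup>2))"

text \<open>Completing the square: the weight \<open>2 / s - s\<close> is the one for which the
  square absorbs the product of \<open>u1\<^sup>2\<close> and \<open>um\<^sup>2\<close>. The linear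
  term in \<open>um\<^sup>2\<close> left over joins \<open>2 * q * um\<^sup>2\<close>, which is the
  origin of the threshold \<open>(1 - 1 / s) * A\<close> for \<open>q\<close>.\<close>

lemma H_TF_minus_affine_minorant:
  assumes "1 < s"
  shows "H_TF (s\<^sup>2 - 1) q (u1, u0, um) - affine_minorant s A q (u1, u0, um) =
    (u0\<^sup>2 + s * u1\<^sup>2 + (2 / s - s) * um\<^sup>2 - A)\<^sup>2 / 2
    + 2 * (q - (1 - 1 / s) * A) * um\<^sup>2 + 2 * (1 - 1 / s\<^sup>2) * um ^ 4
    + u0\<^sup>2 * ((s - 1) / s) * ((s * u1 - (s + 1) * um)\<^sup>2 + um\<^sup>2)"
proof -
  have "sgn (s\<^sup>2 - 1) = 1" using one_less_power[OF assms, of 2] by simp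
  moreover have "s \<noteq> 0" using assms by simp
  ultimately show ?thesis
    by (simp add: affine_minorant_def field_simps power2_eq_square power4_eq_xxxx)
qed

lemma H_TF_ge_affine_minorant:
  assumes "1 < s" "(1 - 1 / s) * A < q"
  shows "affine_minorant s A q v \<le> H_TF (s\<^sup>2 - 1) q v"
proof -
  obtain u1 u0 um where v: "v = (u1, u0, um)" by (cases v)
  have "1 / s\<^sup>2 \<le> 1" using one_less_power[OF assms(1), of 2] by (simp add: divide_le_eq_1)
  then have "0 \<le> H_TF (s\<^sup>2 - 1) q v - affine_minorant s A q v"
    unfolding v H_TF_minus_affine_minorant[OF assms(1)] using assms
    by (intro add_nonneg_nonneg mult_nonneg_nonneg) auto
  then show ?thesis by simp
qed

text \<open>Nonnegative terms with sum 0 all vanish: the strict bound on \<open>q\<close> forces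
  \<open>um = 0\<close>, the last term then forces \<open>u0 = 0\<close> or \<open>u1 = 0\<close>,
  and the square fixes the other component up to its sign, which \<open>nonneg\<close>
  decides.\<close>

lemma H_TF_eq_affine_minorant_iff:
  fixes v :: spin
  assumes s: "1 < s" and A: "0 < A" and q: "(1 - 1 / s) * A < q"
    and nonneg: "0 \<le> fst v" "0 \<le> fst (snd v)"
  shows "H_TF (s\<^sup>2 - 1) q v = affine_minorant s A q v \<longleftrightarrow>
    v = (sqrt (A / s), 0, 0) \<or> v = (0, sqrt A, 0)"
proof
  obtain u1 u0 um where v: "v = (u1, u0, um)" by (cases v)
  assume "H_TF (s\<^sup>2 - 1) q v = affine_minorant s A q v"
  then have zero: "(u0\<^sup>2 + s * u1\<^sup>2 + (2 / s - s) * um\<^sup>2 - A)\<^sup>2 / 2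
    + 2 * (q - (1 - 1 / s) * A) * um\<^sup>2 + 2 * (1 - 1 / s\<^sup>2) * um ^ 4
    + u0\<^sup>2 * ((s - 1) / s) * ((s * u1 - (s + 1) * um)\<^sup>2 + um\<^sup>2) = 0"
    (is "?p + ?r + ?t + ?w = 0")
    unfolding H_TF_minus_affine_minorant[OF s, symmetric] v by simp
  have "1 / s\<^sup>2 \<le> 1" using one_less_power[OF s, of 2] by (simp add: divide_le_eq_1)
  then have "0 \<le> ?t" by simp
  moreover have "0 \<le> ?p" by simp
  moreover have "0 \<le> ?r" using q by simp
  moreover have "0 \<le> ?w" using s by simp
  ultimately have z: "?p = 0" "?r = 0" "?w = 0" using zero by linarith+
  have um: "um = 0" using z(2) q by auto
  have "u0 = 0 \<or> u1 = 0" using z(3) s um by auto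
  moreover have "u0\<^sup>2 + s * u1\<^sup>2 = A" using z(1) um by simp
  ultimately have "u0 = 0 \<and> u1\<^sup>2 = A / s \<or> u1 = 0 \<and> u0\<^sup>2 = A"
    using s by (auto simp: field_simps)
  then show "v = (sqrt (A / s), 0, 0) \<or> v = (0, sqrt A, 0)"
    using nonneg um v by (auto simp: real_sqrt_unique)
next
  assume "v = (sqrt (A / s), 0, 0) \<or> v = (0, sqrt A, 0)"
  then have "H_TF (s\<^sup>2 - 1) q v - affine_minorant s A q v = 0"
    using A s H_TF_minus_affine_minorant[OF s, of q "sqrt (A / s)" 0 0 A]
      H_TF_minus_affine_minorant[OF s, of q 0 "sqrt A" 0 A]
    by (auto simp del: H_TF.simps)
  then show "H_TF (s\<^sup>2 - 1) q v = affine_minorant s A q v" by simp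
qed

section \<open>Integrals over admissible functions\<close>

lemma energy_eq_integral_diff:
  "energy \<Omega> \<alpha> q u = integral_diff (lebesgue_on \<Omega>) (\<lambda>x. H_TF \<alpha> q (u x))"
  by (simp add: energy_def integral_diff_def)

lemma admissible_integrals:
  assumes "admissible \<Omega> N M u"
  shows "integrable (lebesgue_on \<Omega>) (\<lambda>x. case u x of (u1, u0, um) \<Rightarrow> u1\<^sup>2 + u0\<^sup>2 + um\<^sup>2)"
    and "integrable (lebesgue_on \<Omega>) (\<lambda>x. case u x of (u1, u0, um) \<Rightarrow> u1\<^sup>2 - um\<^sup>2)"
  using assms by (auto simp: admissible_def L2_nonneg_def case_prod_beta)

text \<open>By linearity the integral depends on \<open>u\<close> only through the two constraints;
  finite volume takes care of the constant term.\<close>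

lemma admissible_affine_minorant:
  assumes "admissible \<Omega> N M u" and "\<Omega> \<in> lmeasurable"
  shows "integrable (lebesgue_on \<Omega>) (\<lambda>x. affine_minorant s A q (u x))"
    and "(LINT x|lebesgue_on \<Omega>. affine_minorant s A q (u x)) =
      A * (N + (s - 1) * M) - A\<^sup>2 / 2 * measure lebesgue \<Omega> + q * M"
proof -
  let ?P = "\<lambda>x. case u x of (u1, u0, um) \<Rightarrow> u1\<^sup>2 + u0\<^sup>2 + um\<^sup>2"
  let ?Q = "\<lambda>x. case u x of (u1, u0, um) \<Rightarrow> u1\<^sup>2 - um\<^sup>2"
  let ?L = "lebesgue_on \<Omega>"
  have eq: "affine_minorant s A q (u x) = A * (?P x + (s - 1) * ?Q x) - A\<^sup>2 / 2 + q * ?Q x" for x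
    by (simp add: affine_minorant_def split: prod.split)
  interpret finite_measure ?L
    using assms(2) by (intro finite_measure_lebesgue_on)
  note i = admissible_integrals[OF assms(1)]
  show "integrable ?L (\<lambda>x. affine_minorant s A q (u x))"
    unfolding eq using i by (intro Bochner_Integration.integrable_add
        Bochner_Integration.integrable_diff integrable_mult_right) auto
  have PQ: "integral\<^sup>L ?L ?P = N" "integral\<^sup>L ?L ?Q = M"
    using assms(1) by (auto simp: admissible_def)
  have vol: "measure ?L (space ?L) = measure lebesgue \<Omega>"
    using assms(2) by (simp add: measure_restrict_space)
  show "(LINT x|?L. affine_minorant s A q (u x)) =
      A * (N + (s - 1) * M) - A\<^sup>2 / 2 * measure lebesgue \<Omega> + q * M"
    unfolding eq using i PQ vol by simp
qed

lemma admissible_H_TF_measurable: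
  assumes "admissible \<Omega> N M u"
  shows "(\<lambda>x. H_TF \<alpha> q (u x)) \<in> borel_measurable (lebesgue_on \<Omega>)"
proof -
  have [measurable]: "(\<lambda>x. fst (u x)) \<in> borel_measurable (lebesgue_on \<Omega>)"
    "(\<lambda>x. fst (snd (u x))) \<in> borel_measurable (lebesgue_on \<Omega>)"
    "(\<lambda>x. snd (snd (u x))) \<in> borel_measurable (lebesgue_on \<Omega>)"
    using assms by (auto simp: admissible_def L2_nonneg_def)
  \<comment> \<open>\<open>H_TF\<close> is defined by pattern matching; once \<open>u x\<close> is
    written as a triple, it unfolds to a polynomial in the measurable components.\<close>
  have "H_TF \<alpha> q (u x) = H_TF \<alpha> q (fst (u x), fst (snd (u x)), snd (snd (u x)))" for x
    by simp
  then show ?thesis unfolding H_TF.simps by simp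
qed

section \<open>Functions with two values\<close>

definition two_phase :: "'a set \<Rightarrow> 'a set \<Rightarrow> spin \<Rightarrow> spin \<Rightarrow> 'a \<Rightarrow> spin" where
  "two_phase \<Omega> U a b = (\<lambda>x. indicat_real U x *\<^sub>R a + indicat_real (\<Omega> - U) x *\<^sub>R b)"

lemma two_phase_cases:
  "U \<subseteq> \<Omega> \<Longrightarrow> x \<in> \<Omega> \<Longrightarrow> two_phase \<Omega> U a b x = (if x \<in> U then a else b)"
  by (auto simp: two_phase_def)

text \<open>The first component separates \<open>a\<close> from \<open>b\<close>, so the set where
  it is nonzero is measurable and marks the phase \<open>a\<close>.\<close>

lemma AE_two_phase_subset:
  assumes u: "(\<lambda>x. fst (u x)) \<in> borel_measurable (lebesgue_on \<Omega>)" and \<Omega>: "\<Omega> \<in> lmeasurable"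
    and ab: "fst a \<noteq> 0" "fst b = 0"
    and AE: "AE x in lebesgue_on \<Omega>. u x = a \<or> u x = b"
  obtains U where "U \<in> sets lebesgue" "U \<subseteq> \<Omega>" "AE x in lebesgue_on \<Omega>. u x = two_phase \<Omega> U a b x"
proof
  define U where "U = {x \<in> space (lebesgue_on \<Omega>). fst (u x) \<noteq> 0}"
  note u[measurable]
  have "U \<in> sets (lebesgue_on \<Omega>)" unfolding U_def by measurable
  then show "U \<in> sets lebesgue"
    using \<Omega> by (simp add: sets_restrict_space_iff fmeasurableD)
  show sub: "U \<subseteq> \<Omega>" by (auto simp: U_def)
  show "AE x in lebesgue_on \<Omega>. u x = two_phase \<Omega> U a b x"
    using AE AE_space[of "lebesgue_on \<Omega>"]
  proof eventually_elim
    case (elim x)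
    then have "x \<in> \<Omega>" "x \<in> U \<longleftrightarrow> fst (u x) \<noteq> 0" by (auto simp: U_def)
    then show ?case using elim(1) ab by (auto simp: two_phase_cases[OF sub])
  qed
qed

text \<open>On \<open>\<Omega>\<close> the composition is \<open>f b\<close> plus
  \<open>f a - f b\<close> times the indicator of \<open>U\<close>, for any function
  \<open>f\<close> whatsoever.\<close>

lemma integral_two_phase:
  fixes f :: "spin \<Rightarrow> real"
  assumes U: "U \<in> sets lebesgue" "U \<subseteq> \<Omega>" and \<Omega>: "\<Omega> \<in> lmeasurable"
  shows "integrable (lebesgue_on \<Omega>) (\<lambda>x. f (two_phase \<Omega> U a b x))" (is ?i)
    and "(LINT x|lebesgue_on \<Omega>. f (two_phase \<Omega> U a b x)) =
      f a * measure lebesgue U + f b * (measure lebesgue \<Omega> - measure lebesgue U)" (is ?e)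
proof -
  let ?L = "lebesgue_on \<Omega>"
  interpret finite_measure ?L
    using \<Omega> by (intro finite_measure_lebesgue_on)
  have meas: "U \<in> sets ?L"
    using U \<Omega> by (simp add: sets_restrict_space_iff fmeasurableD)
  have vol: "measure ?L \<Omega> = measure lebesgue \<Omega>" "measure ?L U = measure lebesgue U"
    using U \<Omega> by (simp_all add: measure_restrict_space)
  have sp: "U \<inter> \<Omega> = U" using U by auto
  have eq: "f (two_phase \<Omega> U a b x) = f b + (f a - f b) * indicat_real U x" if "x \<in> space ?L" for x
    using that U by (auto simp: two_phase_cases)
  have i: "integrable ?L (indicat_real U)"
    using meas by (rule integrable_real_indicator) (simp add: less_top[symmetric])
  show ?i
    using i by (subst Bochner_Integration.integrable_cong[OF refl eq]) auto
  show ?e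
    using i by (subst Bochner_Integration.integral_cong[OF refl eq])
      (auto simp: vol sp algebra_simps)
qed

lemma two_phase_admissible:
  assumes U: "U \<in> sets lebesgue" "U \<subseteq> \<Omega>" and \<Omega>: "\<Omega> \<in> lmeasurable"
    and N: "x\<^sup>2 * measure lebesgue U + y\<^sup>2 * (measure lebesgue \<Omega> - measure lebesgue U) = N"
    and M: "x\<^sup>2 * measure lebesgue U = M"
    and nonneg: "0 \<le> x" "0 \<le> y"
  shows "admissible \<Omega> N M (two_phase \<Omega> U (x, 0, 0) (0, y, 0))" (is "admissible \<Omega> N M ?u")
proof -
  \<comment> \<open>Stated for general \<open>f\<close> so that the three components are
    instances.\<close>
  have L2: "L2_nonneg \<Omega> (\<lambda>z. f (?u z))" if "0 \<le> f (x, 0, 0)" "0 \<le> f (0, y, 0)" for f :: "spin \<Rightarrow> real"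
    unfolding L2_nonneg_def
  proof (intro conjI)
    show "(\<lambda>z. f (?u z)) \<in> borel_measurable (lebesgue_on \<Omega>)"
      using integral_two_phase(1)[OF U \<Omega>] by (rule borel_measurable_integrable)
    show "integrable (lebesgue_on \<Omega>) (\<lambda>z. (f (?u z))\<^sup>2)"
      using integral_two_phase(1)[OF U \<Omega>, of "\<lambda>v. (f v)\<^sup>2"] .
    show "AE z in lebesgue_on \<Omega>. 0 \<le> f (?u z)"
      using that U by (intro AE_I2) (auto simp: two_phase_cases)
  qed
  show ?thesis
    unfolding admissible_def
    using L2[of fst] L2[of "\<lambda>v. fst (snd v)"] L2[of "\<lambda>v. snd (snd v)"] nonneg N M
      integral_two_phase(2)[OF U \<Omega>, of "\<lambda>v. case v of (u1, u0, um) \<Rightarrow> u1\<^sup>2 + u0\<^sup>2 + um\<^sup>2"]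
      integral_two_phase(2)[OF U \<Omega>, of "\<lambda>v. case v of (u1, u0, um) \<Rightarrow> u1\<^sup>2 - um\<^sup>2"]
    by auto
qed

section \<open>Existence and form of the minimizers\<close>

theorem theorem3p1:
  fixes \<Omega> :: "(real^3) set" and \<alpha> q N M n m q2 A :: real and a b :: spin
  assumes "bounded_smooth_domain \<Omega>"
    and "N > 0" and "0 \<le> M" and "M \<le> N"
    and "n = N / measure lebesgue \<Omega>" and "m = M / measure lebesgue \<Omega>"
    and "0 < \<alpha>" and "\<alpha> \<le> 1" and "m \<ge> 0"
    and "q2 = (1 - 1 / sqrt (\<alpha> + 1)) * (n + (sqrt (\<alpha> + 1) - 1) * m)"
    and "q > q2"
    and "A = n + (sqrt (\<alpha> + 1) - 1) * m"
    and "a = (sqrt (A / sqrt (\<alpha> + 1)), 0, 0)"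
    and "b = (0, sqrt A, 0)"
  shows "(\<exists>u. global_minimizer_P0 \<Omega> \<alpha> q N M u) \<and>
    (\<forall>u. global_minimizer_P0 \<Omega> \<alpha> q N M u \<longrightarrow>
      (\<exists>U. U \<in> sets lebesgue \<and> U \<subseteq> \<Omega> \<and>
        measure lebesgue U =
          sqrt (\<alpha> + 1) * m / (n + (sqrt (\<alpha> + 1) - 1) * m) * measure lebesgue \<Omega> \<and>
        (AE x in lebesgue_on \<Omega>.
          u x = indicat_real U x *\<^sub>R a + indicat_real (\<Omega> - U) x *\<^sub>R b)))"
proof -
  define s where "s = sqrt (\<alpha> + 1)"
  let ?L = "lebesgue_on \<Omega>" and ?V = "measure lebesgue \<Omega>"
  have s: "1 < s" and \<alpha>: "\<alpha> = s\<^sup>2 - 1"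
    using \<open>0 < \<alpha>\<close> by (auto simp: s_def)
  have \<Omega>: "open \<Omega>" "\<Omega> \<noteq> {}" "bounded \<Omega>"
    using assms(1) by (auto simp: bounded_smooth_domain_def)
  then have lm: "\<Omega> \<in> lmeasurable" by (simp add: lmeasurable_open)
  have "\<not> negligible \<Omega>" using \<Omega> open_not_negligible by blast
  then have V: "0 < ?V"
    using lm by (simp add: negligible_iff_measure zero_less_measure_iff)
  have A: "A = n + (s - 1) * m" and a: "a = (sqrt (A / s), 0, 0)" and b: "b = (0, sqrt A, 0)"
    using assms by (simp_all add: s_def)
  have q: "(1 - 1 / s) * A < q"
    using assms by (simp add: s_def)
  have nV: "n * ?V = N" and mV: "m * ?V = M" using V assms by auto
  have n: "0 < n" using V assms by simp
  then have Apos: "0 < A" using s \<open>m \<ge> 0\<close> unfolding A by (simp add: add_pos_nonneg)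
  have "m \<le> n" using V assms by (simp add: divide_right_mono)
  \<comment> \<open>This keeps the prescribed measure of the phase \<open>a\<close> within the
    volume of \<open>\<Omega>\<close>.\<close>
  then have mA: "s * m \<le> A" by (simp add: A algebra_simps)
  let ?g = "\<lambda>u x. affine_minorant s A q (u x)"
  have ge: "ereal (integral\<^sup>L ?L (?g v)) \<le> energy \<Omega> \<alpha> q v" if "admissible \<Omega> N M v" for v
    unfolding energy_eq_integral_diff \<alpha>
    using that lm s q
    by (intro integral_diff_ge admissible_affine_minorant admissible_H_TF_measurable AE_I2
        H_TF_ge_affine_minorant)
  have const: "integral\<^sup>L ?L (?g v) = integral\<^sup>L ?L (?g w)"
    if "admissible \<Omega> N M v" "admissible \<Omega> N M w" for v w
    using that lm by (simp add: admissible_affine_minorant(2))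

  \<comment> \<open>The measure dictated by the magnetization: only the phase \<open>a\<close>
    contributes, with density \<open>A / s\<close>, so \<open>A / s * t = M\<close> is
    required.\<close>
  define t where "t = s * m / A * ?V"
  have "0 \<le> t" using s Apos V \<open>m \<ge> 0\<close> by (simp add: t_def)
  moreover have "s * m / A \<le> 1" using mA Apos by simp
  then have "t \<le> ?V" using V mult_right_mono[of "s * m / A" 1 ?V] unfolding t_def by simp
  ultimately obtain U where U: "U \<in> sets lebesgue" "U \<subseteq> \<Omega>" "measure lebesgue U = t"
    using lmeasurable_subset_of_measure[OF lm \<Omega>(3)] by metis
  define u where "u = two_phase \<Omega> U a b"
  have As: "A / s * t = M" using s Apos mV by (simp add: t_def)
  have At: "A * t = s * M" using As s by (simp add: field_simps)
  \<comment> \<open>The choice of \<open>A\<close> makes the mass constraint follow from the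
    magnetization constraint.\<close>
  have AV: "A * ?V = N + (s - 1) * M" using nV mV by (simp add: A algebra_simps)
  have adm: "admissible \<Omega> N M u"
    unfolding u_def a b
  proof (rule two_phase_admissible[OF U(1,2) lm])
    show "(sqrt (A / s))\<^sup>2 * measure lebesgue U = M"
      using As s Apos U(3) by simp
    have "A / s * t + A * (?V - t) = N"
      using As At AV by (simp add: algebra_simps)
    then show "(sqrt (A / s))\<^sup>2 * measure lebesgue U +
        (sqrt A)\<^sup>2 * (?V - measure lebesgue U) = N"
      using s Apos U(3) by simp
  qed (use s Apos in auto)
  have iff: "H_TF \<alpha> q v = affine_minorant s A q v \<longleftrightarrow> v = a \<or> v = b"
    if "0 \<le> fst v" "0 \<le> fst (snd v)" for v
    using H_TF_eq_affine_minorant_iff[OF s Apos q that] by (simp add: \<alpha> a b)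
  \<comment> \<open>Both values of \<open>u\<close> are contact points, so \<open>u\<close> attains
    the lower bound \<open>ge\<close>.\<close>
  have "H_TF \<alpha> q (u x) = ?g u x" if "x \<in> \<Omega>" for x
    using that U(2) iff[of a] iff[of b] s Apos by (simp add: u_def two_phase_cases a b)
  then have "energy \<Omega> \<alpha> q u = integral_diff ?L (?g u)"
    unfolding energy_eq_integral_diff integral_diff_def
    by (auto intro!: arg_cong2[where f = minus] arg_cong[where f = enn2ereal] nn_integral_cong)
  also have "\<dots> = ereal (integral\<^sup>L ?L (?g u))"
    by (intro integral_diff_integrable admissible_affine_minorant[OF adm lm])
  finally have energy_u: "energy \<Omega> \<alpha> q u = ereal (integral\<^sup>L ?L (?g u))" .
  have "global_minimizer_P0 \<Omega> \<alpha> q N M u"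
    unfolding global_minimizer_P0_def energy_u using adm ge const[OF adm] by auto
  moreover have "\<exists>U. U \<in> sets lebesgue \<and> U \<subseteq> \<Omega> \<and> measure lebesgue U = t \<and>
      (AE x in ?L. v x = two_phase \<Omega> U a b x)"
    if "global_minimizer_P0 \<Omega> \<alpha> q N M v" for v
  proof -
    have v: "admissible \<Omega> N M v" and "energy \<Omega> \<alpha> q v \<le> energy \<Omega> \<alpha> q u"
      using that adm by (auto simp: global_minimizer_P0_def)
    \<comment> \<open>The minorant has the same integral along \<open>u\<close> and
      \<open>v\<close>, so the energy of \<open>v\<close> is at most the integral of its own
      minorant, and equality holds almost everywhere.\<close>
    then have "integral_diff ?L (\<lambda>x. H_TF \<alpha> q (v x)) \<le> ereal (integral\<^sup>L ?L (?g v))"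
      by (simp add: energy_u const[OF v adm] flip: energy_eq_integral_diff)
    then have "AE x in ?L. H_TF \<alpha> q (v x) = ?g v x"
      using v lm s q unfolding \<alpha>
      by (intro integral_diff_eq_imp_AE admissible_affine_minorant admissible_H_TF_measurable AE_I2
        H_TF_ge_affine_minorant)
    moreover have "AE x in ?L. 0 \<le> fst (v x)" "AE x in ?L. 0 \<le> fst (snd (v x))"
      using v by (auto simp: admissible_def L2_nonneg_def)
    ultimately have "AE x in ?L. v x = a \<or> v x = b"
      by eventually_elim (simp add: iff)
    moreover have "(\<lambda>x. fst (v x)) \<in> borel_measurable ?L"
      using v by (auto simp: admissible_def L2_nonneg_def)
    ultimately obtain W where W: "W \<in> sets lebesgue" "W \<subseteq> \<Omega>"
        and vW: "AE x in ?L. v x = two_phase \<Omega> W a b x"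
      using AE_two_phase_subset[of v \<Omega> a b] lm s Apos by (auto simp: a b)
    let ?Q = "\<lambda>w::spin. case w of (u1, u0, um) \<Rightarrow> u1\<^sup>2 - um\<^sup>2"
    \<comment> \<open>The magnetization constraint determines the measure of \<open>W\<close>, since
      \<open>b\<close> carries no magnetization.\<close>
    have "M = (LINT x|?L. ?Q (v x))" using v by (simp add: admissible_def)
    also have "\<dots> = (LINT x|?L. ?Q (two_phase \<Omega> W a b x))"
      using vW admissible_integrals(2)[OF v] integral_two_phase(1)[OF W lm, of ?Q a b]
      by (intro integral_cong_AE) (auto intro: borel_measurable_integrable)
    also have "\<dots> = A / s * measure lebesgue W"
      using s Apos by (simp add: integral_two_phase(2)[OF W lm] a b)
    finally have "A / s * measure lebesgue W = A / s * t" using As by (simp only:)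
    then have "measure lebesgue W = t" using s Apos by simp
    then show ?thesis using W vW by blast
  qed
  ultimately show ?thesis
    unfolding t_def A two_phase_def s_def by blast
qed

end
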